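(* Let $G$ be a finite simple connected graph with $n$ vertices and diameter $d$. Then $\psi(G)\leq n-d+1$.
   Context: $d(u,v)$ denotes the length of a shortest path between $u$ and $v$ in $G$, and the diameter of $G$ is $\max_{u,v\in V(G)} d(u,v)$. Two vertices $u,v$ of a connected graph $G$ are doubly resolved by vertices $x,y$ of $G$ if $d(v,x)-d(u,x)\neq d(v,y)-d(u,y)$. A set $W\subseteq V(G)$ is a doubly resolving set for $G$ if every two distinct vertices of $G$ are doubly resolved by some two vertices of $W$. The doubly resolving number $\psi(G)$ is the minimum cardinality of a doubly resolving set for $G$. *)

theory Defs
  imports "Graph_Theory.Graph_Theory"
begin

text \<open>
  A finite simple graph is a \<open>graph\<close> in the sense of the Graph Theory library: a finite,
  loop-free, symmetric digraph without parallel arcs, each undirected edge being a pair of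
  opposite arcs. Paths are the library's \<open>apath\<close>s (no repeated vertex), given by their lists
  of arcs, so that the length of the list is the length of the path. The empty list is the
  path from a vertex to itself.
\<close>

text \<open>The value is unspecified if no path from \<open>u\<close> to \<open>v\<close> exists.\<close>

definition gdist :: "('a, 'b) pre_digraph \<Rightarrow> 'a \<Rightarrow> 'a \<Rightarrow> nat" where
  "gdist G u v = (LEAST k. \<exists>p. pre_digraph.apath G u p v \<and> length p = k)"

definition gdiameter :: "('a, 'b) pre_digraph \<Rightarrow> nat" where
  "gdiameter G = Max {gdist G u v | u v. u \<in> verts G \<and> v \<in> verts G}"

definition doubly_resolved_by :: "('a, 'b) pre_digraph \<Rightarrow> 'a \<Rightarrow> 'a \<Rightarrow> 'a \<Rightarrow> 'a \<Rightarrow> bool" where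
  "doubly_resolved_by G u v x y \<longleftrightarrow>
     int (gdist G v x) - int (gdist G u x) \<noteq> int (gdist G v y) - int (gdist G u y)"

text \<open>The vertices \<open>x\<close> and \<open>y\<close> below are automatically distinct.\<close>

definition doubly_resolving_set :: "('a, 'b) pre_digraph \<Rightarrow> 'a set \<Rightarrow> bool" where
  "doubly_resolving_set G W \<longleftrightarrow> W \<subseteq> verts G \<and>
     (\<forall>u\<in>verts G. \<forall>v\<in>verts G. u \<noteq> v \<longrightarrow> (\<exists>x\<in>W. \<exists>y\<in>W. doubly_resolved_by G u v x y))"

text \<open>
  In a finite connected graph the set of all vertices is doubly resolving (take \<open>x = u\<close> and
  \<open>y = v\<close>), so the minimum exists. For the one-vertex graph the empty set qualifies vacuously.
\<close>

definition doubly_resolving_number :: "('a, 'b) pre_digraph \<Rightarrow> nat" where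
  "doubly_resolving_number G = (LEAST k. \<exists>W. doubly_resolving_set G W \<and> card W = k)"

end

theory Submission
  imports Defs
begin

text \<open>
  Let \<open>a\<close> and \<open>b\<close> be vertices at distance \<open>d\<close> equal to the diameter, joined by a shortest path
  \<open>a = x\<^sub>0, x\<^sub>1, \<dots>, x\<^sub>d = b\<close>. All vertices except the inner ones \<open>x\<^sub>1, \<dots>, x\<^sub>d\<^sub>-\<^sub>1\<close> of this path form a
  doubly resolving set \<open>W\<close>, which has \<open>n - d + 1\<close> elements if \<open>d > 0\<close>, and \<open>n\<close> elements if \<open>d = 0\<close>.
  To see that \<open>W\<close> is doubly resolving, let \<open>u \<noteq> v\<close>.

  If both are in \<open>W\<close>, they resolve themselves doubly: the differences are \<open>d(u,v)\<close> and \<open>-d(u,v)\<close>.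
  If both are inner vertices, say \<open>x\<^sub>i\<close> and \<open>x\<^sub>j\<close>, then \<open>a\<close> and \<open>b\<close> give the differences \<open>j - i\<close> and
  \<open>i - j\<close>. If \<open>v \<in> W\<close> and \<open>u\<close> is an inner vertex, assume that \<open>d(v,y) - d(u,y)\<close> has the same value
  \<open>c\<close> for all \<open>y \<in> W\<close>. Taking \<open>y = v\<close> gives \<open>c = -d(u,v) < 0\<close>, so \<open>v\<close> is closer than \<open>u\<close> to both
  \<open>a\<close> and \<open>b\<close>. But \<open>u\<close> lies on a shortest path between \<open>a\<close> and \<open>b\<close>, so this contradicts the
  triangle inequality (\<open>doubly_resolved_if_between\<close>).
\<close>

section \<open>The distance as a metric\<close>

context wf_digraph
begin

text \<open>
  Cutting the closed subwalks out of a walk leaves a path whose arcs are distinct and belong to the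
  walk, so walks are never shorter than the distance.
\<close>

lemma gdist_le_length_awalk:
  assumes "awalk u p v"
  shows "gdist G u v \<le> length p"
proof -
  let ?q = "awalk_to_apath p"
  have q: "apath u ?q v"
    using assms by (rule apath_awalk_to_apath)
  then have "distinct ?q"
    unfolding apath_def by (auto intro: distinct_verts_imp_distinct)
  then have "length ?q = card (set ?q)"
    by (simp add: distinct_card)
  also have "\<dots> \<le> card (set p)"
    using awalk_to_apath_subset[OF assms] by (intro card_mono) auto
  also have "\<dots> \<le> length p"
    by (rule card_length)
  finally have "length ?q \<le> length p" .
  moreover have "gdist G u v \<le> length ?q"
    unfolding gdist_def using q by (intro Least_le) blast
  ultimately show ?thesis
    by simp
qed

lemma obtain_shortest_awalk:
  assumes "u \<rightarrow>\<^sup>* v"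
  obtains p where "awalk u p v" "length p = gdist G u v"
proof -
  have "\<exists>k p. apath u p v \<and> length p = k"
    using assms unfolding reachable_apath by blast
  then have "\<exists>p. apath u p v \<and> length p = gdist G u v"
    unfolding gdist_def by (rule LeastI_ex)
  then show thesis
    using that awalkI_apath by blast
qed

lemma gdist_self:
  assumes "u \<in> verts G"
  shows "gdist G u u = 0"
  using gdist_le_length_awalk[of u "[]" u] assms by (simp add: awalk_Nil_iff)

lemma gdist_pos:
  assumes "u \<rightarrow>\<^sup>* v" "u \<noteq> v"
  shows "gdist G u v > 0"
  using assms by (metis obtain_shortest_awalk awalk_Nil_iff length_greater_0_conv)

lemma gdist_triangle:
  assumes "u \<rightarrow>\<^sup>* v" "v \<rightarrow>\<^sup>* w"
  shows "gdist G u w \<le> gdist G u v + gdist G v w"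
proof -
  obtain p where p: "awalk u p v" "length p = gdist G u v"
    using assms(1) by (rule obtain_shortest_awalk)
  obtain q where q: "awalk v q w" "length q = gdist G v w"
    using assms(2) by (rule obtain_shortest_awalk)
  have "gdist G u w \<le> length (p @ q)"
    using p(1) q(1) by (intro gdist_le_length_awalk awalk_appendI)
  then show ?thesis
    using p(2) q(2) by simp
qed

text \<open>
  The vertex at position \<open>i\<close> of a shortest walk splits it into walks of lengths \<open>i\<close> and
  \<open>d(a,b) - i\<close>. By the triangle inequality neither part can be shortened.
\<close>

lemma exists_vertex_at_distance_between:
  assumes "a \<rightarrow>\<^sup>* b" "i \<le> gdist G a b"
  shows "\<exists>x \<in> verts G. gdist G a x = i \<and> gdist G x b = gdist G a b - i"
proof -
  obtain p where p: "awalk a p b" "length p = gdist G a b"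
    using assms(1) by (rule obtain_shortest_awalk)
  let ?x = "awlast a (take i p)"
  have "awalk a (take i p @ drop i p) b"
    using p(1) by simp
  then have walks: "awalk a (take i p) ?x" "awalk ?x (drop i p) b"
    unfolding awalk_append_iff by auto
  have "gdist G a ?x \<le> i"
    using gdist_le_length_awalk[OF walks(1)] by simp
  moreover have "gdist G ?x b \<le> gdist G a b - i"
    using gdist_le_length_awalk[OF walks(2)] p(2) by simp
  moreover have "gdist G a b \<le> gdist G a ?x + gdist G ?x b"
    using walks by (intro gdist_triangle reachable_awalkI)
  ultimately show ?thesis
    using assms(2) awalk_last_in_verts[OF walks(1)] by (intro bexI[of _ ?x]) auto
qed

end

text \<open>Reversing every arc of a walk gives a walk of the same length.\<close>

lemma (in sym_digraph) awalk_reverse: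
  assumes "awalk u p v"
  shows "\<exists>q. awalk v q u \<and> length q = length p"
  using assms
proof (induction p arbitrary: u)
  case Nil
  then show ?case
    by (auto simp: awalk_Nil_iff)
next
  case (Cons e p)
  then have e: "e \<in> arcs G" "u = tail G e" and "awalk (head G e) p v"
    by (auto simp: awalk_Cons_iff)
  then obtain q where q: "awalk v q (head G e)" "length q = length p"
    using Cons.IH by blast
  obtain e' where e': "e' \<in> arcs G" "tail G e = head G e'" "head G e = tail G e'"
    using sym_arcs e(1) unfolding symmetric_conv by blast
  then have "awalk (head G e) [e'] u"
    using e by (simp add: awalk_Cons_iff awalk_Nil_iff)
  then have "awalk v (q @ [e']) u"
    using q(1) by (rule awalk_appendI[rotated])
  then show ?case
    using q(2) by (metis length_append_singleton length_Cons)
qed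

lemma (in sym_digraph) gdist_commute:
  assumes "u \<rightarrow>\<^sup>* v"
  shows "gdist G u v = gdist G v u"
proof -
  have le: "gdist G y x \<le> gdist G x y" if "x \<rightarrow>\<^sup>* y" for x y
    using that by (metis obtain_shortest_awalk awalk_reverse gdist_le_length_awalk)
  show ?thesis
    using le[OF assms] le[OF symmetric_reachable'[OF assms]] by simp
qed

section \<open>Doubly resolving pairs in connected graphs\<close>

lemma doubly_resolved_by_commute:
  "doubly_resolved_by G u v x y \<longleftrightarrow> doubly_resolved_by G v u x y"
  unfolding doubly_resolved_by_def by linarith

locale connected_graph = graph G for G :: "('a, 'b) pre_digraph" (structure) +
  assumes connected: "Digraph_Component.connected G"
begin

lemma verts_nonempty: "verts G \<noteq> {}"
  using connected unfolding connected_def strongly_connected_def by auto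

lemma reachable_verts:
  assumes "u \<in> verts G" "v \<in> verts G"
  shows "u \<rightarrow>\<^sup>* v"
  using symmetric_connected_imp_strongly_connected[OF sym_arcs connected] assms
  unfolding strongly_connected_def by blast

lemma gdiameter_attained:
  obtains a b where "a \<in> verts G" "b \<in> verts G" "gdist G a b = gdiameter G"
proof -
  let ?D = "{gdist G u v | u v. u \<in> verts G \<and> v \<in> verts G}"
  have "?D = (\<lambda>(u, v). gdist G u v) ` (verts G \<times> verts G)"
    by auto
  then have "finite ?D"
    by (metis finite_cartesian_product finite_imageI finite_verts)
  moreover have "?D \<noteq> {}"
    using verts_nonempty by blast
  ultimately have "gdiameter G \<in> ?D"
    unfolding gdiameter_def by (rule Max_in)
  then obtain u v where "u \<in> verts G" "v \<in> verts G" "gdiameter G = gdist G u v"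
    by blast
  then show thesis
    using that by metis
qed

lemma doubly_resolved_by_self:
  assumes "u \<in> verts G" "v \<in> verts G" "u \<noteq> v"
  shows "doubly_resolved_by G u v u v"
  using gdist_pos[OF reachable_verts[OF assms(1,2)] assms(3)]
    gdist_self[OF assms(1)] gdist_self[OF assms(2)]
  unfolding doubly_resolved_by_def by linarith

text \<open>
  If the pairs \<open>(v,a)\<close> and \<open>(v,b)\<close> both fail, then \<open>v\<close> is closer than \<open>u\<close> by \<open>d(u,v)\<close> to \<open>a\<close> and
  to \<open>b\<close>. The detour through \<open>v\<close> would then be shorter than \<open>d(a,b)\<close>.
\<close>

lemma doubly_resolved_if_between:
  assumes verts: "a \<in> verts G" "b \<in> verts G" "u \<in> verts G" "v \<in> verts G"
    and "u \<noteq> v"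
    and between: "gdist G a u + gdist G u b = gdist G a b"
  shows "doubly_resolved_by G u v v a \<or> doubly_resolved_by G u v v b"
proof (rule ccontr)
  assume "\<not> ?thesis"
  moreover have "gdist G v v = 0" "gdist G u v > 0"
    using verts \<open>u \<noteq> v\<close> by (auto intro: gdist_self gdist_pos reachable_verts)
  ultimately have "gdist G v a < gdist G u a" "gdist G v b < gdist G u b"
    unfolding doubly_resolved_by_def by linarith+
  moreover have "gdist G v a = gdist G a v" "gdist G u a = gdist G a u"
    using verts by (auto intro: gdist_commute reachable_verts)
  moreover have "gdist G a b \<le> gdist G a v + gdist G v b"
    using verts by (intro gdist_triangle reachable_verts)
  ultimately show False
    using between by linarith
qed

text \<open>
  The assumptions on \<open>I\<close> are what is used of the inner vertices of a geodesic from \<open>a\<close> to \<open>b\<close>. Moving along a geodesic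
  changes the distances to its two ends by opposite amounts, so the ends separate any two of its
  vertices.
\<close>

lemma doubly_resolving_set_Diff_geodesic:
  assumes verts: "a \<in> verts G" "b \<in> verts G" and "I \<subseteq> verts G"
    and ends: "a \<notin> I" "b \<notin> I"
    and between: "\<And>u. u \<in> I \<Longrightarrow> gdist G a u + gdist G u b = gdist G a b"
    and inj: "inj_on (gdist G a) I"
  shows "doubly_resolving_set G (verts G - I)"
proof -
  let ?W = "verts G - I"
  have ab: "a \<in> ?W" "b \<in> ?W"
    using verts ends by auto
  have inner_outer: "\<exists>x\<in>?W. \<exists>y\<in>?W. doubly_resolved_by G u v x y" if "u \<in> I" "v \<in> ?W" for u v
    using doubly_resolved_if_between[of a b u v] between[of u] that ab \<open>I \<subseteq> verts G\<close> by blast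
  have "\<exists>x\<in>?W. \<exists>y\<in>?W. doubly_resolved_by G u v x y"
    if "u \<in> verts G" "v \<in> verts G" "u \<noteq> v" for u v
  proof (cases "u \<in> I"; cases "v \<in> I")
    assume I: "u \<in> I" "v \<in> I"
    have "gdist G a u \<noteq> gdist G a v"
      using inj I \<open>u \<noteq> v\<close> by (auto dest: inj_onD)
    moreover have "gdist G a u = gdist G u a" "gdist G a v = gdist G v a"
      using verts that by (auto intro: gdist_commute reachable_verts)
    ultimately have "doubly_resolved_by G u v a b"
      using between[OF I(1)] between[OF I(2)] unfolding doubly_resolved_by_def by linarith
    then show ?thesis
      using ab by blast
  next
    assume "u \<in> I" "v \<notin> I"
    then show ?thesis
      using inner_outer that by blast
  next
    assume "u \<notin> I" "v \<in> I"
    then show ?thesis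
      using inner_outer[of v u] that by (simp add: doubly_resolved_by_commute[of G u v])
  next
    assume "u \<notin> I" "v \<notin> I"
    then show ?thesis
      using doubly_resolved_by_self[OF that] that by blast
  qed
  then show ?thesis
    unfolding doubly_resolving_set_def by blast
qed

section \<open>Discarding the inner vertices of a diametral path\<close>

lemma doubly_resolving_number_le:
  "int (doubly_resolving_number G) \<le> int (card (verts G)) - int (gdiameter G) + 1"
proof -
  obtain a b where ab: "a \<in> verts G" "b \<in> verts G" "gdist G a b = gdiameter G"
    by (rule gdiameter_attained)
  define d where "d = gdiameter G"
  have "\<exists>y. y \<in> verts G \<and> gdist G a y = i \<and> gdist G y b = d - i" if "i \<in> {1..<d}" for i
    using exists_vertex_at_distance_between[OF reachable_verts[OF ab(1,2)], of i] ab(3) that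
    unfolding d_def by auto
  then obtain x where
    x: "\<And>i. i \<in> {1..<d} \<Longrightarrow> x i \<in> verts G \<and> gdist G a (x i) = i \<and> gdist G (x i) b = d - i"
    by metis
  define I where "I = x ` {1..<d}"
  have "I \<subseteq> verts G"
    using x unfolding I_def by blast
  have I: "u = x (gdist G a u) \<and> gdist G a u \<in> {1..<d} \<and> gdist G u b = d - gdist G a u"
    if "u \<in> I" for u
    using x that unfolding I_def by auto
  have "a \<notin> I"
    using I[of a] gdist_self[OF ab(1)] by auto
  moreover have "b \<notin> I"
    using I[of b] ab(3) unfolding d_def by auto
  moreover have "gdist G a u + gdist G u b = gdist G a b" if "u \<in> I" for u
    using I[OF that] ab(3) unfolding d_def by auto
  moreover have "inj_on (gdist G a) I"
    using I by (intro inj_on_inverseI[of _ x]) simp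
  ultimately have "doubly_resolving_set G (verts G - I)"
    using ab(1,2) \<open>I \<subseteq> verts G\<close> by (intro doubly_resolving_set_Diff_geodesic)
  then have "doubly_resolving_number G \<le> card (verts G - I)"
    unfolding doubly_resolving_number_def by (intro Least_le) blast
  moreover have "inj_on x {1..<d}"
    using x by (intro inj_on_inverseI[of _ "gdist G a"]) simp
  \<comment> \<open>In the degenerate case \<open>d = 0\<close> the truncated difference is the right cardinality, \<open>0\<close>.\<close>
  then have "card I = d - 1"
    unfolding I_def by (simp add: card_image)
  moreover have "card (verts G - I) + card I = card (verts G)"
    using card_Diff_subset[of I "verts G"] card_mono[OF finite_verts, of I] \<open>I \<subseteq> verts G\<close>
      finite_subset[OF _ finite_verts] by simp
  ultimately show ?thesis
    unfolding d_def by linarith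
qed

end

theorem theorem2p4:
  fixes G :: "('a, 'b) pre_digraph" and n d :: nat
  assumes "graph G"
    and "Digraph_Component.connected G"
    and "n = card (verts G)"
    and "d = gdiameter G"
  shows "int (doubly_resolving_number G) \<le> int n - int d + 1"
proof -
  interpret graph G
    by fact
  interpret connected_graph G
    by unfold_locales fact
  show ?thesis
    using doubly_resolving_number_le assms(3,4) by simp
qed

end
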